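(* Let $(x_k)_{k\ge 0}$, $(y_k)_{k\ge 1}$ be generated by the Inertial Forward-Backward algorithm with parameter sequence $(t_k)_{k\ge1}$ and inertial parameters $\gamma_k=\frac{t_k-1}{t_{k+1}}$. Suppose that Assumption $A_1$ (local error bound condition) and Assumption $A_2$ hold, and that there exists a sequence $(s_k)_{k\ge 1}$ of nonnegative real numbers with $s_{k+1}\neq 0$ for all $k\ge1$ such that $\alpha_k:=\frac{s_k-1}{s_{k+1}}\ge\gamma_k$ for all sufficiently large $k$. Let $x_*\in X$. Then, as $k\to\infty$, $$F(x_{k+1})-F(x_* )=o\left(\frac{1}{s_{k+1}^2}\right)\quad\text{and}\quad \|x_{k+1}-x_k\|=O\left(\frac{1}{s_{k+1}}\right).$$ Further, if $\sum_{k=1}^\infty\frac{1}{s_{k+1}}$ is convergent, then $(x_k)$ converges strongly (i.e. in norm) to a minimizer of $F$.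
   Context: Setting. $H$ is a real Hilbert space; $f:H\to\mathbb{R}$ is convex and continuously differentiable with $L_f$-Lipschitz continuous gradient ($L_f>0$); $g:H\to\mathbb{R}\cup\{+\infty\}$ is proper, lower semicontinuous and convex; $F:=f+g$. It is assumed that $X:=\arg\min F\neq\emptyset$, and $F_*:=\min F=F(x_* )$ for $x_*\in X$. For $\lambda>0$, $\mathrm{prox}_{\lambda g}(z):=\arg\min_{x\in H}\{g(x)+\frac{1}{2\lambda}\|x-z\|^2\}$ and $T_\lambda(x):=\mathrm{prox}_{\lambda g}(x-\lambda\nabla f(x))$. Inertial Forward-Backward algorithm (IFB). Fix $\mu\in(0,1)$, $\lambda=\mu/L_f$, a starting point $x_0\in H$, $y_1=x_0$, and a sequence of positive reals $(t_k)_{k\ge1}$ with $t_1=1$. For $k\ge1$: $x_k=T_\lambda(y_k)$ and $y_{k+1}=x_k+\gamma_k(x_k-x_{k-1})$, where $\gamma_k=\frac{t_k-1}{t_{k+1}}$. Assumption $A_1$ (local error bound condition): for any $\xi\ge F_*$ there exist $\varepsilon>0$ and $\bar\tau>0$ such that $\mathrm{dist}(x,X)\le\bar\tau\,\|T_{1/L_f}(x)-x\|$ whenever $\|T_{1/L_f}(x)-x\|<\varepsilon$ and $F(x)\le\xi$. Assumption $A_2$: there exist $\sigma\in(0,1]$ and $c>0$ such that $\lim_{k\to\infty}k^\sigma\left(\frac{t_{k+1}}{t_k}-1\right)=c$. *)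

theory Defs
  imports "HOL-Analysis.Analysis" "HOL-Library.Landau_Symbols"
begin

definition proper :: "('a \<Rightarrow> ereal) \<Rightarrow> bool" where
  "proper g \<longleftrightarrow> (\<forall>x. g x \<noteq> -\<infinity>) \<and> (\<exists>x. g x \<noteq> \<infinity>)"

definition lsc :: "('a::topological_space \<Rightarrow> ereal) \<Rightarrow> bool" where
  "lsc g \<longleftrightarrow> (\<forall>x. g x \<le> Liminf (at x) g)"

(* Intended for functions that never take the value -\<infinity>, so that the right-hand side is
   never \<infinity> - \<infinity>; for u = 0 it uses the convention 0 * \<infinity> = 0. *)
definition convex_ereal :: "('a::real_vector \<Rightarrow> ereal) \<Rightarrow> bool" where
  "convex_ereal g \<longleftrightarrow>
     (\<forall>x y. \<forall>u\<ge>0. \<forall>v\<ge>0. u + v = 1 \<longrightarrow>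
        g (u *\<^sub>R x + v *\<^sub>R y) \<le> ereal u * g x + ereal v * g y)"

definition argmin_set :: "('a \<Rightarrow> ereal) \<Rightarrow> 'a set" where
  "argmin_set F = {x. is_arg_min F (\<lambda>_. True) x}"

definition composite :: "('a \<Rightarrow> real) \<Rightarrow> ('a \<Rightarrow> ereal) \<Rightarrow> 'a \<Rightarrow> ereal" where
  "composite f g x = ereal (f x) + g x"

(* arg_min picks some minimizer; for proper, lower semicontinuous, convex g on a Hilbert space
   and lam > 0 there is exactly one. *)
definition prox :: "real \<Rightarrow> ('a::real_inner \<Rightarrow> ereal) \<Rightarrow> 'a \<Rightarrow> 'a" where
  "prox lam g z =
     arg_min (\<lambda>x. g x + ereal (1 / (2 * lam) * (norm (x - z))\<^sup>2)) (\<lambda>_. True)"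

definition fb_step :: "('a::real_inner \<Rightarrow> 'a) \<Rightarrow> ('a \<Rightarrow> ereal) \<Rightarrow> real \<Rightarrow> 'a \<Rightarrow> 'a" where
  "fb_step gradf g lam x = prox lam g (x - lam *\<^sub>R gradf x)"

(* The value y 0 plays no role. *)
definition inertial_fb ::
  "('a::real_inner \<Rightarrow> 'a) \<Rightarrow> ('a \<Rightarrow> ereal) \<Rightarrow> real \<Rightarrow> (nat \<Rightarrow> real) \<Rightarrow>
   (nat \<Rightarrow> 'a) \<Rightarrow> (nat \<Rightarrow> 'a) \<Rightarrow> bool" where
  "inertial_fb gradf g lam \<gamma> x y \<longleftrightarrow>
     y 1 = x 0 \<and>
     (\<forall>k\<ge>1. x k = fb_step gradf g lam (y k) \<and>
            y (k + 1) = x k + \<gamma> k *\<^sub>R (x k - x (k - 1)))"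

definition local_error_bound ::
  "('a::real_inner \<Rightarrow> real) \<Rightarrow> ('a \<Rightarrow> 'a) \<Rightarrow> ('a \<Rightarrow> ereal) \<Rightarrow> real \<Rightarrow> bool" where
  "local_error_bound f gradf g L \<longleftrightarrow>
     (\<forall>\<xi>::real. (INF z. composite f g z) \<le> ereal \<xi> \<longrightarrow>
        (\<exists>\<epsilon>>0. \<exists>\<tau>>0. \<forall>x.
           norm (fb_step gradf g (1 / L) x - x) < \<epsilon> \<and> composite f g x \<le> ereal \<xi> \<longrightarrow>
           infdist x (argmin_set (composite f g)) \<le> \<tau> * norm (fb_step gradf g (1 / L) x - x)))"

definition assumption_A2 :: "(nat \<Rightarrow> real) \<Rightarrow> bool" where
  "assumption_A2 t \<longleftrightarrow>
     (\<exists>\<sigma> c. 0 < \<sigma> \<and> \<sigma> \<le> 1 \<and> 0 < c \<and>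
        (\<lambda>k. real k powr \<sigma> * (t (k + 1) / t k - 1)) \<longlonglongrightarrow> c)"

end

theory Submission
  imports Defs
begin

text \<open>
Write \<open>w\<^sub>k = 2\<lambda>(F(x\<^sub>k) - F\<^sub>*)\<close>, \<open>d\<^sub>k = \<parallel>x\<^sub>k - x\<^sub>k\<^sub>-\<^sub>1\<parallel>\<close> and \<open>e\<^sub>k = \<parallel>x\<^sub>k - y\<^sub>k\<parallel>\<close>. The descent inequality of the
forward-backward step at the point \<open>x\<^sub>k\<close> reads
\<open>w\<^sub>k\<^sub>+\<^sub>1 + d\<^sub>k\<^sub>+\<^sub>1\<^sup>2 + (1 - \<mu>) e\<^sub>k\<^sub>+\<^sub>1\<^sup>2 \<le> w\<^sub>k + \<gamma>\<^sub>k\<^sup>2 d\<^sub>k\<^sup>2\<close>. Assumption \<open>A\<^sub>2\<close> gives \<open>\<gamma>\<^sub>k \<longlonglongrightarrow> 1\<close> with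
\<open>0 < \<gamma>\<^sub>k \<le> 1\<close> eventually, so the energy decreases and \<open>e\<^sub>k \<longlonglongrightarrow> 0\<close>; the error bound then applies and yields
\<open>w\<^sub>k \<le> C e\<^sub>k\<^sup>2\<close>. Multiply the inequality by \<open>s\<^sub>k\<^sub>+\<^sub>1\<^sup>2\<close>. Since \<open>\<gamma>\<^sub>k s\<^sub>k\<^sub>+\<^sub>1 \<le> s\<^sub>k - 1\<close>, the velocity term is
at most \<open>s\<^sub>k\<^sup>2 d\<^sub>k\<^sup>2\<close> and \<open>s\<^sub>k\<^sub>+\<^sub>1\<^sup>2 - s\<^sub>k\<^sup>2 \<le> (\<gamma>\<^sub>k\<^sup>-\<^sup>2 - 1) s\<^sub>k\<^sup>2\<close>, where \<open>\<gamma>\<^sub>k\<^sup>-\<^sup>2 - 1 \<longlonglongrightarrow> 0\<close>: the excess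
\<open>(\<gamma>\<^sub>k\<^sup>-\<^sup>2 - 1) s\<^sub>k\<^sup>2 w\<^sub>k\<close> is absorbed by half of the dissipation \<open>(1 - \<mu>) s\<^sub>k\<^sup>2 e\<^sub>k\<^sup>2\<close> of the previous step.
Telescoping bounds \<open>s\<^sub>k d\<^sub>k\<close> and forces \<open>s\<^sub>k\<^sup>2 w\<^sub>k \<le> C s\<^sub>k\<^sup>2 e\<^sub>k\<^sup>2 \<longlonglongrightarrow> 0\<close>.
\<close>

section \<open>Convexity and smoothness along lines\<close>

lemma GDERIV_along_line:
  fixes f :: "'a::real_inner \<Rightarrow> real"
  assumes "GDERIV f (y + u *\<^sub>R v) :> D"
  shows "((\<lambda>u. f (y + u *\<^sub>R v)) has_field_derivative D \<bullet> v) (at u)"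
proof -
  have "((\<lambda>u. y + u *\<^sub>R v) has_derivative (\<lambda>h. h *\<^sub>R v)) (at u)"
    by (auto intro!: derivative_eq_intros)
  from has_derivative_compose[OF this assms[unfolded gderiv_def]] show ?thesis
    unfolding has_field_derivative_def
    by (rule has_derivative_eq_rhs) (auto simp: fun_eq_iff inner_commute)
qed

text \<open>Restriction to the line through \<open>y\<close> and \<open>x\<close> reduces this to
  the tangent inequality for convex functions of one real variable.\<close>

lemma convex_on_ge_tangent_GDERIV:
  fixes f :: "'a::real_inner \<Rightarrow> real"
  assumes conv: "convex_on UNIV f" and grad: "GDERIV f y :> D"
  shows "f y + D \<bullet> (x - y) \<le> f x"
proof -
  define \<phi> where "\<phi> u = f (y + u *\<^sub>R (x - y))" for u :: real
  have "convex_on UNIV \<phi>"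
  proof (rule convex_onI)
    fix t a b :: real
    assume "0 < t" "t < 1"
    have "y + ((1 - t) *\<^sub>R a + t *\<^sub>R b) *\<^sub>R (x - y)
        = (1 - t) *\<^sub>R (y + a *\<^sub>R (x - y)) + t *\<^sub>R (y + b *\<^sub>R (x - y))"
      by (simp add: algebra_simps)
    then show "\<phi> ((1 - t) *\<^sub>R a + t *\<^sub>R b) \<le> (1 - t) * \<phi> a + t * \<phi> b"
      unfolding \<phi>_def using convex_onD[OF conv, of t] \<open>0 < t\<close> \<open>t < 1\<close> by simp
  qed simp
  moreover have "(\<phi> has_field_derivative D \<bullet> (x - y)) (at 0)"
    unfolding \<phi>_def by (rule GDERIV_along_line) (use grad in simp)
  ultimately have "\<phi> 1 - \<phi> 0 \<ge> D \<bullet> (x - y) * (1 - 0)"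
    by (intro convex_on_imp_above_tangent[of UNIV]) auto
  then show ?thesis
    by (simp add: \<phi>_def)
qed

text \<open>On the segment from \<open>y\<close> to \<open>x\<close>, the function minus its
  quadratic model has derivative at most 0, by Cauchy-Schwarz and the Lipschitz bound on the
  gradient. Comparing the two endpoints then replaces an integration.\<close>

lemma descent_lemma:
  fixes f :: "'a::real_inner \<Rightarrow> real"
  assumes grad: "\<And>z. GDERIV f z :> gradf z" and lip: "L-lipschitz_on UNIV gradf"
  shows "f x \<le> f y + gradf y \<bullet> (x - y) + L / 2 * (norm (x - y))\<^sup>2"
proof -
  define \<phi> where "\<phi> u = f (y + u *\<^sub>R (x - y)) - u * (gradf y \<bullet> (x - y))
      - L * u\<^sup>2 / 2 * (norm (x - y))\<^sup>2" for u :: real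
  have "\<phi> 1 \<le> \<phi> 0"
  proof (rule DERIV_nonpos_imp_nonincreasing[of 0 1])
    fix u :: real
    assume "0 \<le> u" "u \<le> 1"
    let ?D = "gradf (y + u *\<^sub>R (x - y))"
    have df: "((\<lambda>u. f (y + u *\<^sub>R (x - y))) has_field_derivative ?D \<bullet> (x - y)) (at u)"
      by (rule GDERIV_along_line[OF grad])
    have "(\<phi> has_field_derivative ?D \<bullet> (x - y) - gradf y \<bullet> (x - y) - L * u * (norm (x - y))\<^sup>2) (at u)"
      unfolding \<phi>_def by (rule derivative_eq_intros df | simp)+
    moreover have "(?D - gradf y) \<bullet> (x - y) \<le> L * u * (norm (x - y))\<^sup>2"
    proof -
      have "(?D - gradf y) \<bullet> (x - y) \<le> norm (?D - gradf y) * norm (x - y)"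
        by (rule norm_cauchy_schwarz)
      also have "norm (?D - gradf y) \<le> L * norm (u *\<^sub>R (x - y))"
        using lipschitz_onD[OF lip, of "y + u *\<^sub>R (x - y)" y] by (simp add: dist_norm)
      finally show ?thesis
        using \<open>0 \<le> u\<close> by (simp add: power2_eq_square mult_right_mono mult.assoc)
    qed
    ultimately show "\<exists>D. (\<phi> has_real_derivative D) (at u) \<and> D \<le> 0"
      by (auto simp: inner_diff_left)
  qed simp
  then show ?thesis
    by (simp add: \<phi>_def)
qed

lemma norm_convex_comb_sq:
  fixes a b :: "'a::real_inner"
  shows "(norm ((1 - u) *\<^sub>R a + u *\<^sub>R b))\<^sup>2
    = (1 - u) * (norm a)\<^sup>2 + u * (norm b)\<^sup>2 - u * (1 - u) * (norm (a - b))\<^sup>2"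
  by (simp add: power2_norm_eq_inner inner_add_left inner_add_right inner_diff_left
      inner_diff_right inner_commute[of b a]) algebra

text \<open>The bounds \<open>r n\<close> may vary with \<open>n\<close>, so that continuous terms
  (a squared norm, or the smooth part of the objective) can be moved to the right-hand side before
  passing to the limit.\<close>

lemma lsc_seq_le:
  fixes g :: "'a::metric_space \<Rightarrow> ereal"
  assumes "lsc g" and X: "X \<longlonglongrightarrow> x" and r: "r \<longlonglongrightarrow> l" and le: "\<And>n. g (X n) \<le> ereal (r n)"
  shows "g x \<le> ereal l"
proof (rule ccontr)
  assume "\<not> ?thesis"
  then obtain c where c: "ereal l < ereal c" "ereal c < g x"
    using ereal_dense2 not_le by metis
  have "g x \<le> Liminf (at x) g"
    using assms(1) by (simp add: lsc_def)
  with c(2) have "\<forall>\<^sub>F z in at x. ereal c < g z"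
    by (auto simp: le_Liminf_iff)
  \<comment> \<open>\<open>lsc\<close> speaks of the punctured filter, but \<open>X\<close> may hit
    \<open>x\<close>; at \<open>x\<close> itself the inequality holds by the choice of
    \<open>c\<close>.\<close>
  then have "\<forall>\<^sub>F z in nhds x. ereal c < g z"
    using c(2) by (auto simp: eventually_at_filter elim!: eventually_mono)
  with X have "\<forall>\<^sub>F n in sequentially. ereal c < g (X n)"
    by (auto simp: filterlim_iff)
  moreover have "\<forall>\<^sub>F n in sequentially. r n < c"
    using c(1) r by (auto simp: order_tendsto_iff)
  ultimately have "\<forall>\<^sub>F n::nat in sequentially. False"
  proof eventually_elim
    case (elim n)
    then have "g (X n) < g (X n)"
      using le[of n] by (metis less_ereal.simps(1) less_trans order_le_less_trans)
    then show ?case by simp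
  qed
  then show False by simp
qed

section \<open>The forward-backward step for a composite convex objective\<close>

locale forward_backward =
  fixes f :: "'a::{real_inner, complete_space} \<Rightarrow> real"
    and gradf :: "'a \<Rightarrow> 'a"
    and g :: "'a \<Rightarrow> ereal"
    and L :: real
  assumes convex_f: "convex_on UNIV f"
    and grad: "\<And>z. GDERIV f z :> gradf z"
    and L_pos: "L > 0"
    and lip: "L-lipschitz_on UNIV gradf"
    and proper: "proper g" and lsc: "lsc g" and convex_g: "convex_ereal g"
    and argmin_nonempty: "argmin_set (composite f g) \<noteq> {}"
begin

text \<open>This is the effective domain of \<open>g\<close>. Off \<open>D\<close> the real-valued
  \<open>G\<close> has the default value 0, so \<open>G\<close> and \<open>\<Phi>\<close> carry
  information only on \<open>D\<close>.\<close>

definition D where "D = {x. g x \<noteq> \<infinity>}"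
definition G where "G x = real_of_ereal (g x)"
definition \<Phi> where "\<Phi> x = f x + G x"

lemma g_eq: "x \<in> D \<Longrightarrow> g x = ereal (G x)"
  using proper by (cases "g x") (auto simp: D_def G_def proper_def)

lemma in_D_leI: "g x \<le> ereal r \<Longrightarrow> x \<in> D \<and> G x \<le> r"
  using g_eq[of x] by (cases "g x = \<infinity>") (auto simp: D_def)

lemma composite_eq: "x \<in> D \<Longrightarrow> composite f g x = ereal (\<Phi> x)"
  by (simp add: composite_def g_eq \<Phi>_def)

lemma composite_infty: "x \<notin> D \<Longrightarrow> composite f g x = \<infinity>"
  by (simp add: composite_def D_def)

lemma D_nonempty: "\<exists>z. z \<in> D"
  using proper by (auto simp: D_def proper_def)

lemma argmin_iff: "x \<in> argmin_set (composite f g) \<longleftrightarrow> x \<in> D \<and> (\<forall>z\<in>D. \<Phi> x \<le> \<Phi> z)"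
proof -
  have "x \<in> argmin_set (composite f g) \<longleftrightarrow> (\<forall>z. composite f g x \<le> composite f g z)"
    by (auto simp: argmin_set_def is_arg_min_def not_less)
  also have "\<dots> \<longleftrightarrow> x \<in> D \<and> (\<forall>z\<in>D. \<Phi> x \<le> \<Phi> z)"
    using D_nonempty by (metis composite_eq composite_infty ereal_infty_less_eq(1)
        ereal_less_eq(1) ereal_less_eq(3) PInfty_neq_ereal(1))
  finally show ?thesis .
qed

lemma convex_G:
  assumes "a \<in> D" "b \<in> D" "0 \<le> u" "u \<le> 1"
  shows "(1 - u) *\<^sub>R a + u *\<^sub>R b \<in> D \<and> G ((1 - u) *\<^sub>R a + u *\<^sub>R b) \<le> (1 - u) * G a + u * G b"
proof (rule in_D_leI)
  have "g ((1 - u) *\<^sub>R a + u *\<^sub>R b) \<le> ereal (1 - u) * g a + ereal u * g b"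
    using convex_g assms(3,4) by (simp add: convex_ereal_def)
  then show "g ((1 - u) *\<^sub>R a + u *\<^sub>R b) \<le> ereal ((1 - u) * G a + u * G b)"
    using assms(1,2) by (simp add: g_eq)
qed

lemma lsc_G:
  assumes "\<And>n. X n \<in> D" "X \<longlonglongrightarrow> x" "r \<longlonglongrightarrow> l" "\<And>n. G (X n) \<le> r n"
  shows "x \<in> D" "G x \<le> l"
proof -
  have "g x \<le> ereal l"
    using assms by (intro lsc_seq_le[OF lsc assms(2,3)]) (simp add: g_eq)
  then show "x \<in> D" "G x \<le> l"
    using in_D_leI by auto
qed

definition prox_obj where "prox_obj lam z x = G x + 1 / (2 * lam) * (norm (x - z))\<^sup>2"

text \<open>Strong convexity with modulus \<open>1 / lam\<close>: convexity of \<open>G\<close> is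
  combined with the exact identity for the squared norm of a convex combination.\<close>

lemma prox_obj_convex:
  assumes "a \<in> D" "b \<in> D" "0 \<le> u" "u \<le> 1" "lam > 0"
  shows "prox_obj lam z ((1 - u) *\<^sub>R a + u *\<^sub>R b)
    \<le> (1 - u) * prox_obj lam z a + u * prox_obj lam z b
      - u * (1 - u) / (2 * lam) * (norm (a - b))\<^sup>2"
proof -
  have "(1 - u) *\<^sub>R a + u *\<^sub>R b - z = (1 - u) *\<^sub>R (a - z) + u *\<^sub>R (b - z)"
    by (simp add: algebra_simps)
  then have eq: "(norm ((1 - u) *\<^sub>R a + u *\<^sub>R b - z))\<^sup>2
    = (1 - u) * (norm (a - z))\<^sup>2 + u * (norm (b - z))\<^sup>2 - u * (1 - u) * (norm (a - b))\<^sup>2"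
    by (simp only: norm_convex_comb_sq) simp
  define K where "K = 1 / (2 * lam)"
  have "u * (1 - u) / (2 * lam) * (norm (a - b))\<^sup>2 = u * (1 - u) * K * (norm (a - b))\<^sup>2"
    by (simp add: K_def)
  moreover have "K * (norm ((1 - u) *\<^sub>R a + u *\<^sub>R b - z))\<^sup>2
    = (1 - u) * (K * (norm (a - z))\<^sup>2) + u * (K * (norm (b - z))\<^sup>2)
      - u * (1 - u) * K * (norm (a - b))\<^sup>2"
    unfolding eq by (simp add: algebra_simps)
  ultimately show ?thesis
    using convex_G[OF assms(1-4), THEN conjunct2]
    unfolding prox_obj_def K_def[symmetric] distrib_left by linarith
qed

text \<open>Strong convexity at midpoints makes a minimizing sequence Cauchy; completeness gives a
  limit, and lower semicontinuity makes the limit a minimizer.\<close>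

lemma prox_obj_minimizer_exists:
  assumes lam: "lam > 0" and bdd: "\<And>x. x \<in> D \<Longrightarrow> B \<le> prox_obj lam z x"
  shows "\<exists>p\<in>D. \<forall>x\<in>D. prox_obj lam z p \<le> prox_obj lam z x"
proof -
  define m where "m = Inf (prox_obj lam z ` D)"
  have bb: "bdd_below (prox_obj lam z ` D)"
    using bdd by (auto simp: bdd_below_def)
  have m_le: "m \<le> prox_obj lam z x" if "x \<in> D" for x
    unfolding m_def using bb that by (intro cInf_lower) auto
  have "\<exists>x\<in>D. prox_obj lam z x < m + 1 / real (Suc n)" for n
  proof -
    have "Inf (prox_obj lam z ` D) < m + 1 / real (Suc n)"
      by (simp add: m_def)
    then show ?thesis
      using D_nonempty bb by (subst (asm) cInf_less_iff) auto
  qed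
  then obtain X where X: "\<And>n. X n \<in> D" "\<And>n. prox_obj lam z (X n) < m + 1 / real (Suc n)"
    by metis
  have dist_le: "(norm (X i - X j))\<^sup>2 \<le> 4 * lam * (1 / real (Suc i) + 1 / real (Suc j))"
    (is "_ \<le> 4 * lam * ?S") for i j
  proof -
    define S where "S = ?S"
    have "m \<le> prox_obj lam z ((1 - 1/2) *\<^sub>R X i + (1/2) *\<^sub>R X j)"
      using convex_G[of "X i" "X j" "1/2"] X(1) by (intro m_le) auto
    also have "\<dots> \<le> (1 - 1/2) * prox_obj lam z (X i) + 1/2 * prox_obj lam z (X j)
        - 1/2 * (1 - 1/2) / (2 * lam) * (norm (X i - X j))\<^sup>2"
      using X(1) lam by (intro prox_obj_convex) auto
    finally have "1 / (8 * lam) * (norm (X i - X j))\<^sup>2 \<le> S / 2"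
      using X(2)[of i] X(2)[of j] by (simp add: S_def)
    then have "(norm (X i - X j))\<^sup>2 \<le> 4 * lam * S"
      using lam by (simp add: field_simps)
    then show ?thesis
      by (simp only: S_def)
  qed
  have "Cauchy X"
  proof (rule metric_CauchyI)
    fix \<epsilon> :: real
    assume "\<epsilon> > 0"
    obtain M where M: "8 * lam / \<epsilon>\<^sup>2 < real (Suc M)"
      using reals_Archimedean2 by (metis less_trans of_nat_less_iff lessI)
    show "\<exists>M. \<forall>m\<ge>M. \<forall>n\<ge>M. dist (X m) (X n) < \<epsilon>"
    proof (intro exI allI impI)
      fix i j
      assume ij: "i \<ge> M" "j \<ge> M"
      have "(norm (X i - X j))\<^sup>2 \<le> 4 * lam * (1 / real (Suc i) + 1 / real (Suc j))"
        by (rule dist_le)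
      also have "\<dots> \<le> 4 * lam * (1 / real (Suc M) + 1 / real (Suc M))"
        using ij lam by (intro mult_left_mono add_mono divide_left_mono) auto
      also have "\<dots> < \<epsilon>\<^sup>2"
        using M \<open>\<epsilon> > 0\<close> by (simp add: field_simps)
      finally show "dist (X i) (X j) < \<epsilon>"
        using \<open>\<epsilon> > 0\<close> by (simp add: dist_norm power2_less_imp_less)
    qed
  qed
  then obtain p where p: "X \<longlonglongrightarrow> p"
    using Cauchy_convergent convergent_def by blast
  \<comment> \<open>With the quadratic term on the right, \<open>r n\<close> bounds
    \<open>G (X n)\<close> and converges, as \<open>lsc_G\<close> requires.\<close>
  define r where "r n = m + 1 / real (Suc n) - 1 / (2 * lam) * (norm (X n - z))\<^sup>2" for n
  have "r \<longlonglongrightarrow> m + 0 - 1 / (2 * lam) * (norm (p - z))\<^sup>2"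
    unfolding r_def by (intro tendsto_intros p LIMSEQ_Suc[OF lim_1_over_n])
  from lsc_G[OF X(1) p this] X(2) have "p \<in> D" "prox_obj lam z p \<le> m"
    by (auto simp: r_def prox_obj_def less_imp_le field_simps)
  then show ?thesis
    using m_le by force
qed

lemma prox_props:
  assumes lam: "lam > 0" and bdd: "\<And>x. x \<in> D \<Longrightarrow> B \<le> prox_obj lam z x"
  shows "prox lam g z \<in> D"
    and "x \<in> D \<Longrightarrow> prox_obj lam z (prox lam g z) + 1 / (2 * lam) * (norm (x - prox lam g z))\<^sup>2
      \<le> prox_obj lam z x"
proof -
  define h where "h x = g x + ereal (1 / (2 * lam) * (norm (x - z))\<^sup>2)" for x
  have h_D: "h x = ereal (prox_obj lam z x)" if "x \<in> D" for x
    using that by (simp add: h_def g_eq prox_obj_def)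
  have h_nD: "h x = \<infinity>" if "x \<notin> D" for x
    using that by (simp add: h_def D_def)
  obtain q where q: "q \<in> D" "\<And>x. x \<in> D \<Longrightarrow> prox_obj lam z q \<le> prox_obj lam z x"
    using prox_obj_minimizer_exists[OF lam bdd] by blast
  \<comment> \<open>Existence of one minimizer ensures that the point chosen by
    \<open>arg_min\<close> is a minimizer as well.\<close>
  have "is_arg_min h (\<lambda>_. True) q"
    using q h_D h_nD by (metis is_arg_min_linorder ereal_less_eq(1) ereal_less_eq(3))
  then have "is_arg_min h (\<lambda>_. True) (prox lam g z)"
    unfolding prox_def arg_min_def h_def[symmetric] by (rule someI)
  then have min: "h (prox lam g z) \<le> h x" for x
    by (auto simp: is_arg_min_linorder)
  show pD: "prox lam g z \<in> D"
    using min[of q] h_D[OF q(1)] h_nD by fastforce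
  let ?p = "prox lam g z"
  assume x: "x \<in> D"
  \<comment> \<open>Quadratic growth around the minimizer: compare \<open>?p\<close> with a point on
    the segment towards \<open>x\<close>, divide by \<open>u\<close>, and let \<open>u\<close> tend
    to 0 afterwards.\<close>
  have "(1 - u) / (2 * lam) * (norm (?p - x))\<^sup>2 \<le> prox_obj lam z x - prox_obj lam z ?p"
    if u: "0 < u" "u < 1" for u
  proof -
    have "(1 - u) *\<^sub>R ?p + u *\<^sub>R x \<in> D"
      using convex_G[OF pD x] u by auto
    then have "prox_obj lam z ?p \<le> prox_obj lam z ((1 - u) *\<^sub>R ?p + u *\<^sub>R x)"
      using min h_D pD by (metis ereal_less_eq(3))
    also have "\<dots> \<le> (1 - u) * prox_obj lam z ?p + u * prox_obj lam z x
      - u * (1 - u) / (2 * lam) * (norm (?p - x))\<^sup>2"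
      using prox_obj_convex[OF pD x] u lam by auto
    finally have "u * ((1 - u) / (2 * lam) * (norm (?p - x))\<^sup>2)
        \<le> u * (prox_obj lam z x - prox_obj lam z ?p)"
      by (simp add: algebra_simps)
    then show ?thesis
      using u by (simp only: mult_le_cancel_left_pos)
  qed
  then have "\<forall>\<^sub>F u in at_right 0. (1 - u) / (2 * lam) * (norm (?p - x))\<^sup>2
      \<le> prox_obj lam z x - prox_obj lam z ?p"
    by (auto simp: eventually_at_right[of 0 1] intro!: exI[of _ 1])
  moreover have "((\<lambda>u. (1 - u) / (2 * lam) * (norm (?p - x))\<^sup>2) \<longlongrightarrow> (1 - 0) / (2 * lam) * (norm (?p - x))\<^sup>2) (at_right 0)"
    using lam by (intro tendsto_intros) auto
  ultimately have "(1 - 0) / (2 * lam) * (norm (?p - x))\<^sup>2 \<le> prox_obj lam z x - prox_obj lam z ?p"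
    by (intro tendsto_upperbound[where F = "at_right (0::real)"]) auto
  then show "prox_obj lam z ?p + 1 / (2 * lam) * (norm (x - ?p))\<^sup>2 \<le> prox_obj lam z x"
    by (simp add: norm_minus_commute)
qed

text \<open>Completing the square turns the proximal objective at the forward point into the
  linearized model plus a summand independent of \<open>x\<close>, which cancels when two points are
  compared.\<close>

lemma prox_obj_shift:
  assumes "lam > 0"
  shows "prox_obj lam (y - lam *\<^sub>R v) x
    = G x + v \<bullet> (x - y) + 1 / (2 * lam) * (norm (x - y))\<^sup>2 + lam / 2 * (norm v)\<^sup>2"
proof -
  have "x - (y - lam *\<^sub>R v) = (x - y) + lam *\<^sub>R v"
    by simp
  then have eq: "(norm (x - (y - lam *\<^sub>R v)))\<^sup>2
      = (norm (x - y))\<^sup>2 + 2 * lam * (v \<bullet> (x - y)) + lam\<^sup>2 * (norm v)\<^sup>2"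
    by (simp only: power2_norm_eq_inner inner_add_left inner_add_right inner_scaleR_left
        inner_scaleR_right inner_commute) (simp add: power2_eq_square)
  have "1 / (2 * lam) * (2 * lam * (v \<bullet> (x - y))) = v \<bullet> (x - y)"
    and "1 / (2 * lam) * (lam\<^sup>2 * (norm v)\<^sup>2) = lam / 2 * (norm v)\<^sup>2"
    using assms by (simp_all add: power2_eq_square)
  then show ?thesis
    unfolding prox_obj_def eq distrib_left by linarith
qed

text \<open>The subproblem is bounded below because \<^term>\<open>composite f g\<close> is: its objective dominates
  \<^term>\<open>\<Phi>\<close> up to a constant when the step size is at most \<^term>\<open>1 / L\<close>.\<close>
lemma fb_step_props:
  assumes lam: "0 < lam" "lam \<le> 1 / L"
  shows fb_step_in_D: "fb_step gradf g lam y \<in> D"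
    and fb_step_three_point: "x \<in> D \<Longrightarrow>
      G (fb_step gradf g lam y) + gradf y \<bullet> (fb_step gradf g lam y - y)
        + 1 / (2 * lam) * (norm (fb_step gradf g lam y - y))\<^sup>2
        + 1 / (2 * lam) * (norm (x - fb_step gradf g lam y))\<^sup>2
      \<le> G x + gradf y \<bullet> (x - y) + 1 / (2 * lam) * (norm (x - y))\<^sup>2"
proof -
  obtain xs where xs: "xs \<in> argmin_set (composite f g)"
    using argmin_nonempty by blast
  have bdd: "\<Phi> xs - f y \<le> prox_obj lam (y - lam *\<^sub>R gradf y) x" if "x \<in> D" for x
  proof -
    have "\<Phi> xs \<le> \<Phi> x"
      using xs that by (simp add: argmin_iff)
    moreover have "f x \<le> f y + gradf y \<bullet> (x - y) + L / 2 * (norm (x - y))\<^sup>2"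
      by (rule descent_lemma[OF grad lip])
    moreover have "L / 2 * (norm (x - y))\<^sup>2 \<le> 1 / (2 * lam) * (norm (x - y))\<^sup>2"
      using lam L_pos by (intro mult_right_mono) (auto simp: field_simps)
    moreover have "0 \<le> lam / 2 * (norm (gradf y))\<^sup>2"
      using lam by simp
    ultimately show ?thesis
      unfolding prox_obj_shift[OF lam(1)] \<Phi>_def by linarith
  qed
  show "fb_step gradf g lam y \<in> D"
    unfolding fb_step_def by (rule prox_props(1)[OF lam(1) bdd])
  assume "x \<in> D"
  from prox_props(2)[OF lam(1) bdd this]
  show "G (fb_step gradf g lam y) + gradf y \<bullet> (fb_step gradf g lam y - y)
        + 1 / (2 * lam) * (norm (fb_step gradf g lam y - y))\<^sup>2
        + 1 / (2 * lam) * (norm (x - fb_step gradf g lam y))\<^sup>2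
      \<le> G x + gradf y \<bullet> (x - y) + 1 / (2 * lam) * (norm (x - y))\<^sup>2"
    unfolding fb_step_def[symmetric] prox_obj_shift[OF lam(1)] by linarith
qed

text \<open>Sum of the three-point inequality, the descent lemma between \<open>y\<close> and
  \<open>p\<close>, and the tangent inequality between \<open>y\<close> and \<open>x\<close>, scaled
  by \<open>2 * lam\<close>. The comparison point is later either the previous iterate or a
  minimizer.\<close>

lemma fb_step_decrease:
  fixes y :: 'a
  assumes lam: "0 < lam" "lam \<le> 1 / L" and "x \<in> D"
  defines "p \<equiv> fb_step gradf g lam y"
  shows "2 * lam * \<Phi> p + (norm (x - p))\<^sup>2 + (1 - lam * L) * (norm (p - y))\<^sup>2
    \<le> 2 * lam * \<Phi> x + (norm (x - y))\<^sup>2"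
proof -
  have "\<Phi> p + 1 / (2 * lam) * (norm (p - y))\<^sup>2 + 1 / (2 * lam) * (norm (x - p))\<^sup>2
      \<le> \<Phi> x + 1 / (2 * lam) * (norm (x - y))\<^sup>2 + L / 2 * (norm (p - y))\<^sup>2"
    using fb_step_three_point[OF lam \<open>x \<in> D\<close>, of y] descent_lemma[OF grad lip, of p y]
      convex_on_ge_tangent_GDERIV[OF convex_f grad, of y x]
    unfolding p_def[symmetric] \<Phi>_def by linarith
  then have "2 * lam * (\<Phi> p + 1 / (2 * lam) * (norm (p - y))\<^sup>2 + 1 / (2 * lam) * (norm (x - p))\<^sup>2)
      \<le> 2 * lam * (\<Phi> x + 1 / (2 * lam) * (norm (x - y))\<^sup>2 + L / 2 * (norm (p - y))\<^sup>2)"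
    using lam by (intro mult_left_mono) auto
  moreover have "2 * lam * (1 / (2 * lam) * c) = c" for c
    using lam by simp
  ultimately have "2 * lam * \<Phi> p + (norm (p - y))\<^sup>2 + (norm (x - p))\<^sup>2
      \<le> 2 * lam * \<Phi> x + (norm (x - y))\<^sup>2 + 2 * lam * (L / 2 * (norm (p - y))\<^sup>2)"
    by (simp only: distrib_left)
  then show ?thesis
    by (simp add: algebra_simps)
qed

text \<open>By polarization the three squares of the three-point inequality collapse to one inner
  product. The result is the optimality condition of \<open>p\<close> in the form of a subgradient
  inequality.\<close>

lemma fb_step_variational:
  fixes y :: 'a
  assumes lam: "0 < lam" "lam \<le> 1 / L" and "x \<in> D"
  defines "p \<equiv> fb_step gradf g lam y"
  shows "G p + gradf y \<bullet> (p - x) + 1 / lam * ((p - y) \<bullet> (p - x)) \<le> G x"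
proof -
  have "(norm (p - y))\<^sup>2 + (norm (x - p))\<^sup>2 - (norm (x - y))\<^sup>2 = 2 * ((p - y) \<bullet> (p - x))"
    by (simp add: power2_norm_eq_inner inner_diff_left inner_diff_right inner_commute)
  then have "1 / (2 * lam) * (norm (p - y))\<^sup>2 + 1 / (2 * lam) * (norm (x - p))\<^sup>2
      - 1 / (2 * lam) * (norm (x - y))\<^sup>2 = 1 / lam * ((p - y) \<bullet> (p - x))"
    unfolding distrib_left[symmetric] right_diff_distrib[symmetric] by simp
  moreover have "gradf y \<bullet> (p - x) = gradf y \<bullet> (p - y) - gradf y \<bullet> (x - y)"
    by (simp add: inner_diff_right)
  ultimately show ?thesis
    using fb_step_three_point[OF lam \<open>x \<in> D\<close>, of y] unfolding p_def[symmetric] by linarith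
qed

text \<open>The error bound measures the residual with step \<open>1 / L\<close>, whereas the
  algorithm uses \<open>\<mu> / L\<close>. Testing the optimality conditions of \<open>p\<close> and
  \<open>?q\<close> against each other cancels \<open>G\<close>; the constant collects 1 from the
  Lipschitz bound and \<open>1 / \<mu>\<close> from the step size.\<close>

lemma fb_step_residual:
  fixes y :: 'a
  assumes \<mu>: "0 < \<mu>" "\<mu> \<le> 1"
  defines "p \<equiv> fb_step gradf g (\<mu> / L) y"
  shows "norm (fb_step gradf g (1 / L) p - p) \<le> (1 + 1 / \<mu>) * norm (p - y)"
proof -
  let ?lam = "\<mu> / L" and ?q = "fb_step gradf g (1 / L) p"
  have lam: "0 < ?lam" "?lam \<le> 1 / L"
    using \<mu> L_pos by (auto simp: divide_right_mono)
  have pD: "p \<in> D"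
    unfolding p_def by (rule fb_step_in_D[OF lam])
  have qD: "?q \<in> D"
    using L_pos by (intro fb_step_in_D) auto
  have q: "G ?q + gradf p \<bullet> (?q - p) + L * ((?q - p) \<bullet> (?q - p)) \<le> G p"
    using fb_step_variational[of "1 / L" p p] L_pos pD by simp
  have p: "G p + gradf y \<bullet> (p - ?q) + L / \<mu> * ((p - y) \<bullet> (p - ?q)) \<le> G ?q"
    using fb_step_variational[OF lam qD, of y] by (simp add: p_def)
  have "L * (norm (?q - p))\<^sup>2 \<le> (gradf y - gradf p) \<bullet> (?q - p) + L / \<mu> * ((p - y) \<bullet> (?q - p))"
    using p q by (simp add: power2_norm_eq_inner inner_diff_left inner_diff_right inner_commute algebra_simps)
  also have "\<dots> \<le> norm (gradf y - gradf p) * norm (?q - p) + L / \<mu> * (norm (p - y) * norm (?q - p))"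
    using \<mu> L_pos by (intro add_mono mult_left_mono norm_cauchy_schwarz) auto
  also have "\<dots> \<le> L * norm (p - y) * norm (?q - p) + L / \<mu> * (norm (p - y) * norm (?q - p))"
    using lipschitz_onD[OF lip, of y p]
    by (intro add_mono mult_right_mono) (auto simp: dist_norm norm_minus_commute)
  also have "\<dots> = L * norm (?q - p) * ((1 + 1 / \<mu>) * norm (p - y))"
    by (simp add: algebra_simps)
  finally have "L * norm (?q - p) * norm (?q - p) \<le> L * norm (?q - p) * ((1 + 1 / \<mu>) * norm (p - y))"
    by (simp add: power2_eq_square algebra_simps)
  then show ?thesis
    using L_pos \<mu> by (cases "?q = p") (auto simp: mult_le_cancel_left_pos)
qed

text \<open>Comparison with an arbitrary minimizer \<open>a\<close> bounds the square root of the
  scaled gap by \<open>dist y a\<close>. Taking the infimum over \<open>a\<close> gives the distance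
  of \<open>y\<close> to the solution set; the triangle inequality moves it to \<open>p\<close>,
  where the error bound will apply.\<close>

lemma fb_step_value_bound:
  fixes y :: 'a
  assumes lam: "0 < lam" "lam \<le> 1 / L" and xs: "xs \<in> argmin_set (composite f g)"
  defines "p \<equiv> fb_step gradf g lam y"
  shows "2 * lam * (\<Phi> p - \<Phi> xs) \<le> (infdist p (argmin_set (composite f g)) + norm (p - y))\<^sup>2"
proof -
  let ?X = "argmin_set (composite f g)" and ?w = "2 * lam * (\<Phi> p - \<Phi> xs)"
  have pD: "p \<in> D"
    unfolding p_def by (rule fb_step_in_D[OF lam])
  have w0: "0 \<le> ?w"
    using xs pD lam by (simp add: argmin_iff)
  have "sqrt ?w \<le> dist y a" if "a \<in> ?X" for a
  proof -
    have aD: "a \<in> D" and "\<Phi> a = \<Phi> xs"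
      using that xs by (auto simp: argmin_iff intro: antisym)
    then have "2 * lam * \<Phi> a = 2 * lam * \<Phi> xs"
      by simp
    moreover have "lam * L \<le> 1"
      using lam L_pos by (simp add: field_simps)
    then have "0 \<le> (1 - lam * L) * (norm (p - y))\<^sup>2"
      by simp
    ultimately have "?w \<le> (dist y a)\<^sup>2"
      using fb_step_decrease[OF lam aD, of y] zero_le_power2[of "norm (a - p)"]
      unfolding p_def[symmetric] dist_norm norm_minus_commute[of y a] right_diff_distrib by linarith
    then show ?thesis
      by (simp add: real_le_lsqrt w0)
  qed
  then have "sqrt ?w \<le> infdist y ?X"
    using argmin_nonempty unfolding infdist_notempty[OF argmin_nonempty] by (intro cINF_greatest) auto
  also have "\<dots> \<le> infdist p ?X + norm (p - y)"
    using infdist_triangle[of y ?X p] by (simp add: dist_norm norm_minus_commute)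
  finally have "(sqrt ?w)\<^sup>2 \<le> (infdist p ?X + norm (p - y))\<^sup>2"
    using w0 by (intro power_mono) auto
  then show ?thesis
    using w0 by simp
qed

end

section \<open>Energy arguments for real sequences\<close>

lemma tendsto_0_of_energy_drop:
  fixes P a :: "nat \<Rightarrow> real"
  assumes drop: "\<forall>\<^sub>F k in sequentially. P (Suc k) + a (Suc k) \<le> P k"
    and P_nonneg: "\<forall>\<^sub>F k in sequentially. 0 \<le> P k"
    and a_nonneg: "\<forall>\<^sub>F k in sequentially. 0 \<le> a k"
  shows "a \<longlonglongrightarrow> 0" and "\<exists>B. \<forall>\<^sub>F k in sequentially. P k \<le> B"
proof -
  from eventually_conj[OF drop eventually_conj[OF P_nonneg a_nonneg]]
  obtain N where N: "\<And>k. k \<ge> N \<Longrightarrow> P (Suc k) + a (Suc k) \<le> P k \<and> 0 \<le> P k \<and> 0 \<le> a k"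
    by (auto simp: eventually_sequentially)
  \<comment> \<open>A tail of \<open>P\<close> decreases and is bounded below by 0, so it converges,
    and \<open>a\<close> is squeezed between 0 and the vanishing decrements.\<close>
  have dec: "decseq (\<lambda>n. P (n + N))"
  proof (rule decseq_SucI)
    show "P (Suc n + N) \<le> P (n + N)" for n
      using N[of "n + N"] N[of "Suc (n + N)"] by simp
  qed
  then obtain l where "(\<lambda>n. P (n + N)) \<longlonglongrightarrow> l"
    using decseq_convergent[of "\<lambda>n. P (n + N)" 0] N by (metis le_add2)
  then have l: "P \<longlonglongrightarrow> l"
    by (rule LIMSEQ_offset)
  have lim: "(\<lambda>k. P k - P (Suc k)) \<longlonglongrightarrow> 0"
    using tendsto_diff[OF l LIMSEQ_Suc[OF l]] by simp
  have "(\<lambda>k. a (Suc k)) \<longlonglongrightarrow> 0"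
  proof (rule tendsto_sandwich[OF _ _ tendsto_const lim])
    show "\<forall>\<^sub>F k in sequentially. 0 \<le> a (Suc k)"
      using N by (auto simp: eventually_sequentially intro!: exI[of _ N])
    show "\<forall>\<^sub>F k in sequentially. a (Suc k) \<le> P k - P (Suc k)"
      using drop by eventually_elim simp
  qed
  then show "a \<longlonglongrightarrow> 0"
    by (rule LIMSEQ_imp_Suc)
  have "\<forall>\<^sub>F k in sequentially. P k < l + 1"
    using l by (rule order_tendstoD) simp
  then show "\<exists>B. \<forall>\<^sub>F k in sequentially. P k \<le> B"
    by (intro exI[of _ "l + 1"]) (auto elim: eventually_mono)
qed

lemma weighted_energy_rates:
  fixes w d e s \<gamma> :: "nat \<Rightarrow> real"
  assumes energy: "\<forall>\<^sub>F k in sequentially. w (Suc k) + (d (Suc k))\<^sup>2 + \<kappa> * (e (Suc k))\<^sup>2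
      \<le> w k + (\<gamma> k)\<^sup>2 * (d k)\<^sup>2"
    and w_le: "\<forall>\<^sub>F k in sequentially. w k \<le> C * (e k)\<^sup>2"
    and w_nonneg: "\<forall>\<^sub>F k in sequentially. 0 \<le> w k"
    and \<kappa>: "\<kappa> > 0"
    and \<gamma>: "\<gamma> \<longlonglongrightarrow> 1"
    and s_pos: "\<forall>\<^sub>F k in sequentially. 0 < s k"
    and s_growth: "\<forall>\<^sub>F k in sequentially. \<gamma> k * s (Suc k) \<le> s k - 1"
  shows "(\<lambda>k. (s k)\<^sup>2 * w k) \<longlonglongrightarrow> 0"
    and "\<exists>B. \<forall>\<^sub>F k in sequentially. (s k * d k)\<^sup>2 \<le> B"
proof -
  \<comment> \<open>Half of the weighted dissipation. One half enters \<open>P\<close> as a reserve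
    that pays for the growth of the weight at the next step; the other half is the drop that must
    vanish.\<close>
  define a where "a k = \<kappa> / 2 * ((s k)\<^sup>2 * (e k)\<^sup>2)" for k
  define P where "P k = (s k)\<^sup>2 * (w k + (d k)\<^sup>2) + a k" for k
  have "(\<lambda>k. C * (1 / (\<gamma> k)\<^sup>2 - 1)) \<longlonglongrightarrow> C * (1 / 1\<^sup>2 - 1)"
    by (intro tendsto_intros \<gamma>) simp
  then have small: "\<forall>\<^sub>F k in sequentially. C * (1 / (\<gamma> k)\<^sup>2 - 1) < \<kappa> / 2"
    by (rule order_tendstoD) (use \<kappa> in simp)
  have \<gamma>_pos: "\<forall>\<^sub>F k in sequentially. 0 < \<gamma> k"
    using \<gamma> by (rule order_tendstoD) simp
  have s_pos': "\<forall>\<^sub>F k in sequentially. 0 < s (Suc k)"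
    using s_pos eventually_sequentially_Suc[of "\<lambda>k. 0 < s k"] by blast
  have drop: "\<forall>\<^sub>F k in sequentially. P (Suc k) + a (Suc k) \<le> P k"
    using energy w_le w_nonneg s_pos s_pos' s_growth small \<gamma>_pos
  proof eventually_elim
    case (elim k)
    have pos: "0 < \<gamma> k * s (Suc k)"
      using elim by simp
    have sq: "(\<gamma> k)\<^sup>2 * (s (Suc k))\<^sup>2 \<le> (s k)\<^sup>2"
      unfolding power_mult_distrib[symmetric] using pos elim by (intro power_mono) auto
    have ss: "(s (Suc k))\<^sup>2 \<le> (s k)\<^sup>2 + (1 / (\<gamma> k)\<^sup>2 - 1) * (s k)\<^sup>2"
      using sq elim by (simp add: field_simps)
    have "(1 / (\<gamma> k)\<^sup>2 - 1) * w k \<le> \<kappa> / 2 * (e k)\<^sup>2"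
    \<comment> \<open>The bound on \<open>w k\<close> can be multiplied by this factor only when the
      factor is nonnegative; for \<open>\<gamma> k \<ge> 1\<close> the left-hand side is at most 0
      anyway.\<close>
    proof (cases "1 / (\<gamma> k)\<^sup>2 - 1 \<le> 0")
      case True
      then have "(1 / (\<gamma> k)\<^sup>2 - 1) * w k \<le> 0"
        using elim by (intro mult_nonpos_nonneg) auto
      also have "0 \<le> \<kappa> / 2 * (e k)\<^sup>2"
        using \<kappa> by simp
      finally show ?thesis .
    next
      case False
      then have "(1 / (\<gamma> k)\<^sup>2 - 1) * w k \<le> (1 / (\<gamma> k)\<^sup>2 - 1) * (C * (e k)\<^sup>2)"
        using elim by (intro mult_left_mono) auto
      also have "\<dots> = (C * (1 / (\<gamma> k)\<^sup>2 - 1)) * (e k)\<^sup>2"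
        by (simp only: ac_simps)
      also have "\<dots> \<le> \<kappa> / 2 * (e k)\<^sup>2"
        using elim by (intro mult_right_mono) auto
      finally show ?thesis .
    qed
    then have "(s k)\<^sup>2 * ((1 / (\<gamma> k)\<^sup>2 - 1) * w k) \<le> (s k)\<^sup>2 * (\<kappa> / 2 * (e k)\<^sup>2)"
      by (rule mult_left_mono) simp
    moreover have "(s (Suc k))\<^sup>2 * w k \<le> ((s k)\<^sup>2 + (1 / (\<gamma> k)\<^sup>2 - 1) * (s k)\<^sup>2) * w k"
      using elim by (intro mult_right_mono ss) auto
    moreover have "((s k)\<^sup>2 + (1 / (\<gamma> k)\<^sup>2 - 1) * (s k)\<^sup>2) * w k
        = (s k)\<^sup>2 * w k + (s k)\<^sup>2 * ((1 / (\<gamma> k)\<^sup>2 - 1) * w k)"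
      by (simp only: distrib_left distrib_right ac_simps)
    moreover have "(s k)\<^sup>2 * (\<kappa> / 2 * (e k)\<^sup>2) = a k"
      by (simp add: a_def)
    ultimately have 1: "(s (Suc k))\<^sup>2 * w k \<le> (s k)\<^sup>2 * w k + a k"
      by linarith
    have 2: "(\<gamma> k)\<^sup>2 * (s (Suc k))\<^sup>2 * (d k)\<^sup>2 \<le> (s k)\<^sup>2 * (d k)\<^sup>2"
      using sq by (rule mult_right_mono) simp
    have "(s (Suc k))\<^sup>2 * (w (Suc k) + (d (Suc k))\<^sup>2 + \<kappa> * (e (Suc k))\<^sup>2)
        \<le> (s (Suc k))\<^sup>2 * (w k + (\<gamma> k)\<^sup>2 * (d k)\<^sup>2)"
      using elim by (intro mult_left_mono) auto
    with 1 2 show ?case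
      by (simp add: P_def a_def algebra_simps)
  qed
  have a_nonneg: "0 \<le> a k" for k
    using \<kappa> by (simp add: a_def)
  have P_nonneg: "\<forall>\<^sub>F k in sequentially. 0 \<le> P k"
    using w_nonneg by eventually_elim (simp add: P_def a_nonneg)
  note limits = tendsto_0_of_energy_drop[OF drop P_nonneg always_eventually[OF allI[OF a_nonneg]]]
  \<comment> \<open>The factor undoes \<open>\<kappa> / 2\<close> in \<open>a\<close> and inserts
    the constant of \<open>w_le\<close>.\<close>
  have lim: "(\<lambda>k. 2 * C / \<kappa> * a k) \<longlonglongrightarrow> 0"
    using tendsto_mult_left[OF limits(1), of "2 * C / \<kappa>"] by simp
  show "(\<lambda>k. (s k)\<^sup>2 * w k) \<longlonglongrightarrow> 0"
  proof (rule tendsto_sandwich[OF _ _ tendsto_const lim])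
    show "\<forall>\<^sub>F k in sequentially. 0 \<le> (s k)\<^sup>2 * w k"
      using w_nonneg by eventually_elim simp
    show "\<forall>\<^sub>F k in sequentially. (s k)\<^sup>2 * w k \<le> 2 * C / \<kappa> * a k"
      using w_le
    proof eventually_elim
      case (elim k)
      then have "(s k)\<^sup>2 * w k \<le> (s k)\<^sup>2 * (C * (e k)\<^sup>2)"
        by (intro mult_left_mono) auto
      then show ?case
        using \<kappa> by (simp add: a_def ac_simps)
    qed
  qed
  from limits(2) obtain B where "\<forall>\<^sub>F k in sequentially. P k \<le> B"
    by blast
  with w_nonneg have "\<forall>\<^sub>F k in sequentially. (s k * d k)\<^sup>2 \<le> B"
  proof eventually_elim
    case (elim k)
    have "0 \<le> (s k)\<^sup>2 * w k"
      using elim by simp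
    with elim a_nonneg[of k] show ?case
      unfolding P_def power_mult_distrib distrib_left by linarith
  qed
  then show "\<exists>B. \<forall>\<^sub>F k in sequentially. (s k * d k)\<^sup>2 \<le> B" ..
qed

section \<open>Asymptotics of the inertial parameters\<close>

lemma filterlim_at_top_of_increments:
  fixes t :: "nat \<Rightarrow> real"
  assumes b: "b > 0" and inc: "\<And>k. k \<ge> N \<Longrightarrow> t k + b / real k \<le> t (Suc k)" and N: "N \<ge> 1"
  shows "filterlim t at_top sequentially"
proof -
  \<comment> \<open>The harmonic sum is bounded below by a logarithm, since
    \<open>ln (k + 1) - ln k \<le> 1 / k\<close>.\<close>
  have "t N + b * (ln (real k) - ln (real N)) \<le> t k" if "k \<ge> N" for k
    using that
  proof (induction k rule: dec_induct)
    case (step k)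
    have "ln (real (Suc k) / real k) \<le> real (Suc k) / real k - 1"
      using step N by (intro ln_le_minus_one) auto
    then have "ln (real (Suc k)) - ln (real k) \<le> 1 / real k"
      using step N by (simp add: ln_div field_simps)
    then have "b * (ln (real (Suc k)) - ln (real k)) \<le> b * (1 / real k)"
      using b by (intro mult_left_mono) auto
    with step inc[of k] show ?case
      by (simp add: algebra_simps)
  qed simp
  then have "\<forall>\<^sub>F k in sequentially. t N + b * (ln (real k) - ln (real N)) \<le> t k"
    by (auto simp: eventually_sequentially)
  moreover have "filterlim (\<lambda>k. ln (real k)) at_top sequentially"
    by (rule filterlim_compose[OF ln_at_top filterlim_real_sequentially])
  then have "filterlim (\<lambda>k. (t N - b * ln (real N)) + b * ln (real k)) at_top sequentially"
    by (intro filterlim_tendsto_add_at_top[OF tendsto_const]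
        filterlim_tendsto_pos_mult_at_top[OF tendsto_const b])
  then have "filterlim (\<lambda>k. t N + b * (ln (real k) - ln (real N))) at_top sequentially"
    by (simp add: algebra_simps)
  ultimately show ?thesis
    by (rule filterlim_at_top_mono[rotated])
qed

text \<open>The quotient equals \<open>(1 - 1 / t k) / (1 + r k)\<close>, so its limit follows from
  \<open>r\<close> tending to 0 and \<open>t\<close> to infinity. The latter holds because
  \<open>\<sigma> \<le> 1\<close> makes \<open>r k\<close> at least of order \<open>1 / k\<close>.
  Eventual monotonicity of \<open>t\<close> gives the upper bound 1.\<close>

lemma inertial_parameter_limit:
  assumes A2: "assumption_A2 t" and t_pos: "\<And>k. k \<ge> 1 \<Longrightarrow> t k > 0"
  shows "(\<lambda>k. (t k - 1) / t (k + 1)) \<longlonglongrightarrow> 1"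
    and "\<forall>\<^sub>F k in sequentially. (t k - 1) / t (k + 1) \<le> 1"
proof -
  define r where "r k = t (k + 1) / t k - 1" for k
  obtain \<sigma> c where \<sigma>: "0 < \<sigma>" "\<sigma> \<le> 1" and c: "0 < c"
    and lim: "(\<lambda>k. real k powr \<sigma> * r k) \<longlonglongrightarrow> c"
    using A2 by (auto simp: assumption_A2_def r_def)
  have "\<forall>\<^sub>F k in sequentially. c / 2 < real k powr \<sigma> * r k"
    using lim c by (intro order_tendstoD(1)) auto
  then obtain N where N: "N \<ge> 1" "\<And>k. k \<ge> N \<Longrightarrow> c / 2 < real k powr \<sigma> * r k"
    unfolding eventually_sequentially by (metis max.bounded_iff max.cobounded2)
  have r_ge: "c / 2 / real k \<le> r k" if "k \<ge> N" for k
  proof -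
    have k1: "real k \<ge> 1"
      using that N(1) by simp
    have pos: "0 < real k powr \<sigma>"
      using k1 by simp
    have "0 < real k powr \<sigma> * r k"
      using N(2)[OF that] c by linarith
    then have "0 < r k"
      using pos by (simp add: zero_less_mult_iff)
    moreover have "real k powr \<sigma> \<le> real k"
      using powr_mono[OF \<sigma>(2) k1] k1 by simp
    ultimately have "real k powr \<sigma> * r k \<le> real k * r k"
      by (intro mult_right_mono) auto
    then show ?thesis
      using N(2)[OF that] k1 by (simp add: field_simps)
  qed
  have t_Suc: "t (k + 1) = t k + r k * t k" if "k \<ge> 1" for k
    using t_pos[OF that] by (simp add: r_def field_simps)
  have t_mono: "t k \<le> t (k + 1)" if "k \<ge> N" for k
  proof -
    have "0 \<le> r k"
      using order_trans[OF _ r_ge[OF that]] c by simp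
    then show ?thesis
      using that N(1) t_Suc[of k] t_pos[of k] by simp
  qed
  have t_ge: "t N \<le> t k" if "k \<ge> N" for k
    using that by (induction k rule: dec_induct) (use t_mono in \<open>auto intro: order_trans\<close>)
  have t_top: "filterlim t at_top sequentially"
  \<comment> \<open>The increment is \<open>r k * t k\<close>, where \<open>r k\<close> is at least
    \<open>c / 2 / k\<close> and \<open>t k\<close> at least \<open>t N\<close>.\<close>
  proof (rule filterlim_at_top_of_increments)
    show "0 < c / 2 * t N"
      using c N(1) t_pos by simp
    show "t k + c / 2 * t N / real k \<le> t (Suc k)" if "k \<ge> N" for k
    proof -
      have "c / 2 / real k * t N \<le> r k * t k"
        using r_ge[OF that] t_ge[OF that] t_pos[OF N(1)] c
        by (intro mult_mono) (auto intro: order_trans[OF _ r_ge[OF that]])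
      then show ?thesis
        using t_Suc[of k] that N(1) by simp
    qed
  qed (rule N(1))
  have "(\<lambda>k. real k powr (- \<sigma>)) \<longlonglongrightarrow> 0"
    using \<sigma> by (intro tendsto_neg_powr filterlim_real_sequentially) auto
  from tendsto_mult[OF this lim] have "(\<lambda>k. real k powr (- \<sigma>) * (real k powr \<sigma> * r k)) \<longlonglongrightarrow> 0"
    by simp
  then have r0: "r \<longlonglongrightarrow> 0"
  proof (rule Lim_transform_eventually)
    show "\<forall>\<^sub>F k in sequentially. real k powr (- \<sigma>) * (real k powr \<sigma> * r k) = r k"
      using eventually_gt_at_top[of 0]
      by eventually_elim (simp add: powr_minus)
  qed
  have "(\<lambda>k. (1 - inverse (t k)) / (1 + r k)) \<longlonglongrightarrow> (1 - 0) / (1 + 0)"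
    by (intro tendsto_intros r0 tendsto_inverse_0_at_top t_top) simp
  then have "(\<lambda>k. (1 - inverse (t k)) / (1 + r k)) \<longlonglongrightarrow> 1"
    by simp
  then show "(\<lambda>k. (t k - 1) / t (k + 1)) \<longlonglongrightarrow> 1"
  proof (rule Lim_transform_eventually)
    show "\<forall>\<^sub>F k in sequentially. (1 - inverse (t k)) / (1 + r k) = (t k - 1) / t (k + 1)"
      using eventually_ge_at_top[of 1]
    proof eventually_elim
      case (elim k)
      then show ?case
        using t_pos[of k] t_pos[of "k + 1"] by (simp add: r_def field_simps)
    qed
  qed
  show "\<forall>\<^sub>F k in sequentially. (t k - 1) / t (k + 1) \<le> 1"
    using eventually_ge_at_top[of N]
  proof eventually_elim
    case (elim k)
    then show ?case
      using t_mono[of k] t_pos[of "k + 1"] by (simp add: field_simps)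
  qed
qed

section \<open>Sequences of finite length\<close>

lemma Cauchy_if_summable_increments:
  fixes z :: "nat \<Rightarrow> 'a::real_normed_vector"
  assumes "summable (\<lambda>n. norm (z (Suc n) - z n))"
  shows "Cauchy z"
proof -
  define S where "S n = (\<Sum>i<n. norm (z (Suc i) - z i))" for n
  have S_diff: "norm (z n - z m) \<le> S n - S m" if "m \<le> n" for m n
    using that
  proof (induction n rule: dec_induct)
    case (step n)
    have "norm (z (Suc n) - z m) \<le> norm (z (Suc n) - z n) + norm (z n - z m)"
      using norm_triangle_ineq[of "z (Suc n) - z n" "z n - z m"] by simp
    with step show ?case
      by (simp add: S_def)
  qed simp
  have le: "dist (z m) (z n) \<le> dist (S m) (S n)" for m n
    using S_diff[of m n] S_diff[of n m]
    by (cases "m \<le> n") (auto simp: dist_norm norm_minus_commute[of "z m"])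
  have "Cauchy S"
    using assms unfolding S_def summable_iff_convergent by (rule convergent_Cauchy)
  then show ?thesis
    unfolding Cauchy_def using le by (meson le_less_trans)
qed

section \<open>Rates and strong convergence of the inertial algorithm\<close>

theorem theorem2p2:
  fixes f :: "'a::{real_inner, complete_space} \<Rightarrow> real"
    and gradf :: "'a \<Rightarrow> 'a"
    and g :: "'a \<Rightarrow> ereal"
    and L \<mu> lam :: real
    and t s \<gamma> \<alpha> :: "nat \<Rightarrow> real"
    and x y :: "nat \<Rightarrow> 'a"
    and xstar :: 'a
  defines "F \<equiv> composite f g"
    and "lam \<equiv> \<mu> / L"
    and "\<gamma> \<equiv> \<lambda>k. (t k - 1) / t (k + 1)"
    and "\<alpha> \<equiv> \<lambda>k. (s k - 1) / s (k + 1)"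
  assumes "convex_on UNIV f"
    and "\<forall>z. GDERIV f z :> gradf z"
    and "continuous_on UNIV gradf"
    and "L > 0"
    and "lipschitz_on L UNIV gradf"
    and "proper g" and "lsc g" and "convex_ereal g"
    and "argmin_set F \<noteq> {}"
    and "0 < \<mu>" and "\<mu> < 1"
    and "\<forall>k\<ge>1. t k > 0" and "t 1 = 1"
    and "inertial_fb gradf g lam \<gamma> x y"
    and "local_error_bound f gradf g L"
    and "assumption_A2 t"
    and "\<forall>k\<ge>1. s k \<ge> 0"
    and "\<forall>k\<ge>1. s (k + 1) \<noteq> 0"
    and "\<forall>\<^sub>F k in sequentially. \<alpha> k \<ge> \<gamma> k"
    and "xstar \<in> argmin_set F"
  shows "(\<forall>k\<ge>1. \<bar>F (x (k + 1))\<bar> \<noteq> \<infinity>) \<and> \<bar>F xstar\<bar> \<noteq> \<infinity> \<and>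
    (\<lambda>k. real_of_ereal (F (x (k + 1))) - real_of_ereal (F xstar)) \<in> o(\<lambda>k. 1 / (s (k + 1))\<^sup>2) \<and>
    (\<lambda>k. norm (x (k + 1) - x k)) \<in> O(\<lambda>k. 1 / s (k + 1)) \<and>
    (summable (\<lambda>k. 1 / s (k + 2)) \<longrightarrow> (\<exists>xbar \<in> argmin_set F. x \<longlonglongrightarrow> xbar))"
proof -
  interpret forward_backward f gradf g L
    by unfold_locales (use assms in auto)
  have F_eq: "F z = ereal (\<Phi> z)" if "z \<in> D" for z
    using that unfolding F_def by (rule composite_eq)
  have lam: "0 < lam" "lam \<le> 1 / L" and lamL: "lam * L = \<mu>"
    using assms(8) \<open>0 < \<mu>\<close> \<open>\<mu> < 1\<close> by (auto simp: lam_def divide_right_mono)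
  have xs: "xstar \<in> argmin_set (composite f g)"
    using assms(24) by (simp add: F_def)
  then have xsD: "xstar \<in> D" and xs_min: "\<And>z. z \<in> D \<Longrightarrow> \<Phi> xstar \<le> \<Phi> z"
    by (auto simp: argmin_iff)
  have x_step: "x k = fb_step gradf g lam (y k)"
    and y_step: "y (Suc k) = x k + \<gamma> k *\<^sub>R (x k - x (k - 1))" if "k \<ge> 1" for k
    using \<open>inertial_fb gradf g lam \<gamma> x y\<close> that by (auto simp: inertial_fb_def)
  have xD: "x k \<in> D" if "k \<ge> 1" for k
    using fb_step_in_D[OF lam] x_step[OF that] by simp
  have \<gamma>_lim: "\<gamma> \<longlonglongrightarrow> 1" and \<gamma>_le: "\<forall>\<^sub>F k in sequentially. \<gamma> k \<le> 1"
    using inertial_parameter_limit[OF \<open>assumption_A2 t\<close>] \<open>\<forall>k\<ge>1. t k > 0\<close>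
    by (auto simp: \<gamma>_def)
  have \<gamma>_pos: "\<forall>\<^sub>F k in sequentially. 0 < \<gamma> k"
    using \<gamma>_lim by (rule order_tendstoD) simp

  define w where "w k = 2 * lam * (\<Phi> (x k) - \<Phi> xstar)" for k
  define d where "d k = norm (x k - x (k - 1))" for k
  define e where "e k = norm (x k - y k)" for k
  have w_nonneg: "0 \<le> w k" if "k \<ge> 1" for k
    using xs_min[OF xD[OF that]] lam by (simp add: w_def)
  have energy: "w (Suc k) + (d (Suc k))\<^sup>2 + (1 - \<mu>) * (e (Suc k))\<^sup>2 \<le> w k + (\<gamma> k)\<^sup>2 * (d k)\<^sup>2"
    if "k \<ge> 1" for k
  proof -
    have "norm (x k - y (Suc k)) = \<bar>\<gamma> k\<bar> * d k"
      by (simp add: y_step[OF that] d_def)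
    then show ?thesis
      using fb_step_decrease[OF lam xD[OF that], of "y (Suc k)"] x_step[of "Suc k"]
      by (simp add: w_def d_def e_def lamL power_mult_distrib norm_minus_commute right_diff_distrib)
  qed
  have ev1: "\<forall>\<^sub>F k in sequentially. k \<ge> (1::nat)"
    by (rule eventually_ge_at_top)
  have w_ev: "\<forall>\<^sub>F k in sequentially. 0 \<le> w k"
    using ev1 by eventually_elim (rule w_nonneg)

  \<comment> \<open>The unweighted energy yields the two prerequisites of the error bound: bounded
    objective values and \<open>e\<close> tending to 0.\<close>
  have "\<forall>\<^sub>F k in sequentially. w (Suc k) + (d (Suc k))\<^sup>2 + (1 - \<mu>) * (e (Suc k))\<^sup>2 \<le> w k + (d k)\<^sup>2"
    using ev1 \<gamma>_le \<gamma>_pos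
  proof eventually_elim
    case (elim k)
    have "(\<gamma> k)\<^sup>2 * (d k)\<^sup>2 \<le> 1 * (d k)\<^sup>2"
      using elim by (intro mult_right_mono power_le_one) auto
    with energy[OF elim(1)] show ?case
      by simp
  qed
  moreover have "\<forall>\<^sub>F k in sequentially. 0 \<le> w k + (d k)\<^sup>2"
    using w_ev by eventually_elim simp
  moreover have "\<forall>\<^sub>F k in sequentially. 0 \<le> (1 - \<mu>) * (e k)\<^sup>2"
    using \<open>\<mu> < 1\<close> by simp
  ultimately have e_lim': "(\<lambda>k. (1 - \<mu>) * (e k)\<^sup>2) \<longlonglongrightarrow> 0"
    and "\<exists>B. \<forall>\<^sub>F k in sequentially. w k + (d k)\<^sup>2 \<le> B"
    by (rule tendsto_0_of_energy_drop)+
  then obtain B where B: "\<forall>\<^sub>F k in sequentially. w k + (d k)\<^sup>2 \<le> B"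
    by blast
  have e2_lim: "(\<lambda>k. (e k)\<^sup>2) \<longlonglongrightarrow> 0"
    using tendsto_mult_left[OF e_lim', of "1 / (1 - \<mu>)"] \<open>\<mu> < 1\<close> by simp
  from tendsto_real_sqrt[OF this] have e_lim: "e \<longlonglongrightarrow> 0"
    by (simp add: e_def[abs_def])

  define M where "M = 1 + 1 / \<mu>"
  have M_pos: "M > 0"
    using \<open>0 < \<mu>\<close> by (simp add: M_def add_pos_pos)
  \<comment> \<open>A level that contains all late iterates; \<open>max 0 B\<close> makes it at
    least the minimal value, as the error bound demands.\<close>
  define \<xi> where "\<xi> = \<Phi> xstar + max 0 B / (2 * lam)"
  have "(INF z. composite f g z) \<le> composite f g xstar"
    by (rule INF_lower) simp
  also have "\<dots> \<le> ereal \<xi>"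
    using lam by (simp add: composite_eq[OF xsD] \<xi>_def)
  finally obtain \<epsilon> \<tau> where \<epsilon>: "\<epsilon> > 0" and \<tau>: "\<tau> > 0" and eb: "\<And>z.
      norm (fb_step gradf g (1 / L) z - z) < \<epsilon> \<Longrightarrow> composite f g z \<le> ereal \<xi> \<Longrightarrow>
      infdist z (argmin_set (composite f g)) \<le> \<tau> * norm (fb_step gradf g (1 / L) z - z)"
    using \<open>local_error_bound f gradf g L\<close> unfolding local_error_bound_def by blast
  \<comment> \<open>The residual is at most \<open>M * e k\<close>, hence the distance to the
    solution set is at most \<open>\<tau> * M * e k\<close>; the added 1 is the term
    \<open>e k\<close> in \<open>fb_step_value_bound\<close>.\<close>
  define C where "C = (\<tau> * M + 1)\<^sup>2"
  have "\<forall>\<^sub>F k in sequentially. e k < \<epsilon> / M"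
    using e_lim by (rule order_tendstoD) (use \<epsilon> M_pos in simp)
  then have w_le: "\<forall>\<^sub>F k in sequentially. w k \<le> C * (e k)\<^sup>2"
    using B ev1
  proof eventually_elim
    case (elim k)
    have res: "norm (fb_step gradf g (1 / L) (x k) - x k) \<le> M * e k"
      using fb_step_residual[of \<mu> "y k"] \<open>0 < \<mu>\<close> \<open>\<mu> < 1\<close> x_step[OF elim(3)]
      by (simp add: M_def e_def lam_def)
    also have "\<dots> < \<epsilon>"
      using elim(1) M_pos by (simp add: field_simps)
    finally have small: "norm (fb_step gradf g (1 / L) (x k) - x k) < \<epsilon>" .
    have "w k \<le> max 0 B"
      using elim(2) zero_le_power2[of "d k"] by linarith
    then have "composite f g (x k) \<le> ereal \<xi>"
      using lam by (simp add: composite_eq[OF xD[OF elim(3)]] \<xi>_def w_def field_simps)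
    from eb[OF small this] have "infdist (x k) (argmin_set (composite f g)) \<le> \<tau> * (M * e k)"
      by (rule order_trans[OF _ mult_left_mono[OF res less_imp_le[OF \<tau>]]])
    then have "infdist (x k) (argmin_set (composite f g)) + e k \<le> (\<tau> * M + 1) * e k"
      by (simp add: algebra_simps)
    then have "(infdist (x k) (argmin_set (composite f g)) + e k)\<^sup>2 \<le> ((\<tau> * M + 1) * e k)\<^sup>2"
      by (intro power_mono) (auto simp: e_def infdist_nonneg)
    then show ?case
      using fb_step_value_bound[OF lam xs, of "y k"] x_step[OF elim(3)]
      by (simp add: w_def e_def C_def power_mult_distrib)
  qed
  \<comment> \<open>This unweighted limit identifies the limit of the iterates as a minimizer at the
    end.\<close>
  have w_lim: "w \<longlonglongrightarrow> 0"
  proof (rule tendsto_sandwich[OF w_ev w_le tendsto_const])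
    show "(\<lambda>k. C * (e k)\<^sup>2) \<longlonglongrightarrow> 0"
      using tendsto_mult_left[OF e2_lim, of C] by simp
  qed

  \<comment> \<open>Positivity starts at index 2, since \<open>s 1\<close> may be 0.\<close>
  have s_Suc_pos: "0 < s (k + 1)" if "k \<ge> 1" for k
    using \<open>\<forall>k\<ge>1. s k \<ge> 0\<close> \<open>\<forall>k\<ge>1. s (k + 1) \<noteq> 0\<close> that by (simp add: less_le)
  have s_pos: "\<forall>\<^sub>F k in sequentially. 0 < s k"
    using eventually_ge_at_top[of 2]
  proof eventually_elim
    case (elim k)
    then show ?case
      using s_Suc_pos[of "k - 1"] by simp
  qed
  have s_growth: "\<forall>\<^sub>F k in sequentially. \<gamma> k * s (Suc k) \<le> s k - 1"
    using \<open>\<forall>\<^sub>F k in sequentially. \<alpha> k \<ge> \<gamma> k\<close> ev1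
  proof eventually_elim
    case (elim k)
    then show ?case
      using s_Suc_pos[of k] by (simp add: \<alpha>_def pos_le_divide_eq)
  qed
  have energy_ev: "\<forall>\<^sub>F k in sequentially.
      w (Suc k) + (d (Suc k))\<^sup>2 + (1 - \<mu>) * (e (Suc k))\<^sup>2 \<le> w k + (\<gamma> k)\<^sup>2 * (d k)\<^sup>2"
    using ev1 by eventually_elim (rule energy)
  have "1 - \<mu> > 0"
    using \<open>\<mu> < 1\<close> by simp
  note rates = weighted_energy_rates[OF energy_ev w_le w_ev this \<gamma>_lim s_pos s_growth]
  have s_pos': "\<forall>\<^sub>F k in sequentially. 0 < s (k + 1)"
    using ev1 by eventually_elim (rule s_Suc_pos)

  \<comment> \<open>Finiteness ensures that \<open>real_of_ereal\<close> returns the actual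
    objective values in the rate.\<close>
  have finite: "\<forall>k\<ge>1. \<bar>F (x (k + 1))\<bar> \<noteq> \<infinity>" "\<bar>F xstar\<bar> \<noteq> \<infinity>"
    by (auto simp: F_eq xD xsD)
  have little_o: "(\<lambda>k. real_of_ereal (F (x (k + 1))) - real_of_ereal (F xstar))
      \<in> o(\<lambda>k. 1 / (s (k + 1))\<^sup>2)"
  proof (rule smalloI_tendsto)
    have "(\<lambda>k. 1 / (2 * lam) * ((s (k + 1))\<^sup>2 * w (k + 1))) \<longlonglongrightarrow> 0"
      using tendsto_mult_left[OF LIMSEQ_ignore_initial_segment[OF rates(1), of 1], of "1 / (2 * lam)"]
      by simp
    then show "(\<lambda>k. (real_of_ereal (F (x (k + 1))) - real_of_ereal (F xstar)) / (1 / (s (k + 1))\<^sup>2))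
        \<longlonglongrightarrow> 0"
      by (rule Lim_transform_eventually)
        (use lam in \<open>auto simp: F_eq xD xsD w_def field_simps\<close>)
    show "\<forall>\<^sub>F k in sequentially. 1 / (s (k + 1))\<^sup>2 \<noteq> 0"
      using s_pos' by eventually_elim simp
  qed
  from rates(2) obtain R where R: "\<forall>\<^sub>F k in sequentially. (s k * d k)\<^sup>2 \<le> R"
    by blast
  have d_le: "\<forall>\<^sub>F k in sequentially. d k \<le> sqrt R * (1 / s k)"
    using R s_pos
  proof eventually_elim
    case (elim k)
    have "s k * d k \<le> sqrt R"
      using elim(1) by (rule real_le_rsqrt)
    then show ?case
      using elim(2) by (simp add: field_simps)
  qed
  have big_O: "(\<lambda>k. norm (x (k + 1) - x k)) \<in> O(\<lambda>k. 1 / s (k + 1))"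
  proof (rule bigoI)
    show "\<forall>\<^sub>F k in sequentially. norm (norm (x (k + 1) - x k)) \<le> sqrt R * norm (1 / s (k + 1))"
      using sequentially_offset[OF d_le, of 1] s_pos'
      by eventually_elim (simp add: d_def)
  qed
  \<comment> \<open>The series of \<open>1 / s (k + 1)\<close> over \<open>k \<ge> 1\<close> is
    shifted by one because \<open>summable\<close> counts from 0.\<close>
  have "\<exists>xbar\<in>argmin_set F. x \<longlonglongrightarrow> xbar" if sum: "summable (\<lambda>k. 1 / s (k + 2))"
  proof -
    have "summable (\<lambda>k. sqrt R * (1 / s (k + 2)))"
      by (rule summable_mult[OF sum])
    moreover have "\<forall>\<^sub>F k in sequentially. norm (d (k + 2)) \<le> sqrt R * (1 / s (k + 2))"
      using sequentially_offset[OF d_le, of 2] by eventually_elim (simp add: d_def)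
    ultimately have "summable (\<lambda>k. d (k + 2))"
      by (rule summable_comparison_test_ev[rotated])
    then have "Cauchy (\<lambda>k. x (k + 1))"
      by (intro Cauchy_if_summable_increments) (simp add: d_def)
    then obtain xbar where xbar': "(\<lambda>k. x (k + 1)) \<longlonglongrightarrow> xbar"
      using Cauchy_convergent convergent_def by blast
    \<comment> \<open>This sequence is \<open>G (x (k + 1))\<close> rewritten through
      \<open>w\<close>; its limit is explicit, so lower semicontinuity of \<open>g\<close> yields
      \<open>\<Phi> xbar \<le> \<Phi> xstar\<close>.\<close>
    have "(\<lambda>k. w (k + 1) / (2 * lam) + \<Phi> xstar - f (x (k + 1)))
        \<longlonglongrightarrow> 0 / (2 * lam) + \<Phi> xstar - f xbar"
    proof (intro tendsto_intros LIMSEQ_ignore_initial_segment[OF w_lim])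
      have "isCont f xbar"
        using grad[of xbar] unfolding gderiv_def by (rule has_derivative_continuous)
      then show "(\<lambda>k. f (x (k + 1))) \<longlonglongrightarrow> f xbar"
        by (rule isCont_tendsto_compose[OF _ xbar'])
    qed (use lam in simp)
    moreover have "G (x (k + 1)) \<le> w (k + 1) / (2 * lam) + \<Phi> xstar - f (x (k + 1))" for k
      using lam by (simp add: w_def \<Phi>_def)
    ultimately have "xbar \<in> D" "G xbar \<le> 0 / (2 * lam) + \<Phi> xstar - f xbar"
      using lsc_G[of "\<lambda>k. x (k + 1)", OF xD xbar'] by auto
    then have "xbar \<in> argmin_set F"
      using xs_min unfolding F_def argmin_iff by (fastforce simp: \<Phi>_def)
    moreover have "x \<longlonglongrightarrow> xbar"
      using xbar' by (rule LIMSEQ_offset)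
    ultimately show ?thesis ..
  qed
  with finite little_o big_O show ?thesis
    by blast
qed

end
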